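(* Let $\bar p\in\mathbb{H}^n$ and $r>0$, let $\tau_{\bar p}:\mathbb{H}^n\to\mathbb{H}^n$, $\tau_{\bar p}(p)=\bar p*p$, be the left translation and $\delta_r:\mathbb{H}^n\to\mathbb{H}^n$, $\delta_r(x,y,t)=(rx,ry,r^2t)$, the anisotropic dilation, and let $S\subseteq\mathbb{H}^n$ be an $\mathbb{H}$-regular $1$-codimensional surface (which, so that $\mathbb{H}$-orientability is defined, is a $1$-codimensional $C^1$-Euclidean surface with $C(S)=\varnothing$). Then the $\mathbb{H}$-regular $1$-codimensional surfaces $\tau_{\bar p}S=\{\bar p*p:p\in S\}$ and $\delta_rS=\{\delta_r(p):p\in S\}$ are (respectively) $\mathbb{H}$-orientable if and only if $S$ is $\mathbb{H}$-orientable.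
   Context: The Heisenberg group $\mathbb{H}^n$, $n\geq1$, is $\mathbb{R}^{2n+1}$ with coordinates $(x,y,t)$, $x,y\in\mathbb{R}^n$, $t\in\mathbb{R}$, and product $(x,y,t)*(x',y',t')=(x+x',y+y',t+t'+\frac12\sum_j(x_jy_j'-y_jx_j'))$. The standard left invariant vector fields are $X_j=\partial_{x_j}-\frac12y_j\partial_t$, $Y_j=\partial_{y_j}+\frac12x_j\partial_t$ ($j=1,\dots,n$), $T=\partial_t$. The horizontal layer is $\mathfrak{h}_1=\operatorname{span}\{X_j,Y_j:j=1,\dots,n\}$ (at a point $p$: $\mathfrak{h}_{1,p}$), with scalar product $\langle\cdot,\cdot\rangle_H$ making the $X_j,Y_j$ orthonormal. A function $f:U\to\mathbb{R}$, $U\subseteq\mathbb{H}^n$ open, is P-differentiable at $p_0\in U$ if there is a (unique) group homomorphism $d_Hf_{p_0}:\mathbb{H}^n\to\mathbb{R}$ with $d_Hf_{p_0}(\delta_\rho p)=\rho\,d_Hf_{p_0}(p)$ for all $\rho>0$ such that $d_Hf_{p_0}(p)=\lim_{\rho\to0}\frac{f(p_0*\delta_\rho(p))-f(p_0)}{\rho}$ uniformly for $p$ in compact sets. Its horizontal gradient is $\nabla_{\mathbb{H}}f=\sum_{j=1}^n[(X_jf)X_j+(Y_jf)Y_j]$. $C^1_{\mathbb{H}}(U,\mathbb{R})$ is the space of continuous $f:U\to\mathbb{R}$ such that $\nabla_{\mathbb{H}}f$ is continuous in $U$ (equivalently, such that the P-differential is continuous). A subset $S\subseteq\mathbb{H}^n$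 is an $\mathbb{H}$-regular $1$-codimensional surface if for every $p\in S$ there are a neighbourhood $U$ of $p$ and $f\in C^1_{\mathbb{H}}(U,\mathbb{R})$ with $S\cap U=\{f=0\}$ and $\nabla_{\mathbb{H}}f\neq0$ on $U$; its horizontal normal vector field is, locally, $\nabla_{\mathbb{H}}f/|\nabla_{\mathbb{H}}f|$. $\mathbb{H}$-regularity of $1$-codimensional surfaces is preserved by left translations and by the dilations $\delta_r$. A $1$-codimensional $C^1$-Euclidean surface $S\subseteq\mathbb{H}^n$ is a subset such that for every $p\in S$ there are a neighbourhood $U$ of $p$ and $g\in C^1(U,\mathbb{R})$ (ordinary Euclidean $C^1$) with $S\cap U=\{g=0\}$ and $\nabla g\neq0$ on $U$ ($\nabla$ the Euclidean gradient). $TS$ denotes the space of vector fields tangent to $S$, $T_pS$ the space of vectors tangent to $S$ at $p$, and the characteristic set is $C(S)=\{p\in S:T_pS\subseteq\mathfrak{h}_{1,p}\}$. If $C(S)=\varnothing$, such a surface is $\mathbb{H}$-regular. Let $S$ be a $1$-codimensional $C^1$-Euclidean surface with $C(S)=\varnothing$. A vector $v\in\mathfrak{h}_1$ and $S$ are $\mathbb{H}$-orthogonal if $\langle v,w_{|\mathfrak{h}_1}\rangle_H=0$ for all $w\in TS$, where $w_{|\mathfrak{h}_1}$ is the restriction of $w$ to $\mathfrak{h}_1$ (its horizontal part). $S$ is $\mathbb{H}$-orientable if there is a continuous horizontal global never-null vector field $n_{\mathbb{H}}=\sum_{i=1}^n(n_{\mathbb{H},i}X_i+n_{\mathbb{H},n+i}Y_i)\neq0$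 defined on $S$ so that $n_{\mathbb{H}}$ and $S$ are $\mathbb{H}$-orthogonal; this $n_{\mathbb{H}}$ is stated to be consistent with the local horizontal normal above. *)

theory Defs
  imports "HOL-Analysis.Analysis"
begin

text \<open>Points of the Heisenberg group, and vectors at a point, are triples \<open>(x, y, t)\<close>; the
  topology is the Euclidean one. The index type \<open>'n\<close> has \<open>n \<ge> 1\<close> elements.\<close>

type_synonym 'n heis = "(real ^ 'n) \<times> (real ^ 'n) \<times> real"

definition hmul :: "'n::finite heis \<Rightarrow> 'n heis \<Rightarrow> 'n heis" where
  "hmul p q = (case p of (x, y, t) \<Rightarrow> case q of (x', y', t') \<Rightarrow>
     (x + x', y + y', t + t' + 1/2 * (\<Sum>j\<in>UNIV. x $ j * y' $ j - y $ j * x' $ j)))"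

definition left_transl :: "'n::finite heis \<Rightarrow> 'n heis \<Rightarrow> 'n heis" where
  "left_transl a = (\<lambda>p. hmul a p)"

definition dil :: "real \<Rightarrow> 'n::finite heis \<Rightarrow> 'n heis" where
  "dil r p = (case p of (x, y, t) \<Rightarrow> (r *\<^sub>R x, r *\<^sub>R y, r\<^sup>2 * t))"

subsection \<open>Left invariant vector fields and the horizontal layer\<close>

definition Xf :: "'n::finite \<Rightarrow> 'n heis \<Rightarrow> 'n heis" where
  "Xf j p = (axis j 1, 0, - (1/2) * (fst (snd p) $ j))"

definition Yf :: "'n::finite \<Rightarrow> 'n heis \<Rightarrow> 'n heis" where
  "Yf j p = (0, axis j 1, 1/2 * (fst p $ j))"

definition Tf :: "'n::finite heis \<Rightarrow> 'n heis" where
  "Tf p = (0, 0, 1)"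

definition hlayer :: "'n::finite heis \<Rightarrow> 'n heis set" where
  "hlayer p = span (range (\<lambda>j. Xf j p) \<union> range (\<lambda>j. Yf j p))"

text \<open>If \<open>v = \<Sum>j. a j X j + b j Y j + c T\<close> at some point, then \<open>a\<close> and \<open>b\<close> are the first two
  components of \<open>v\<close>; on each horizontal layer \<open>inner_H\<close> is thus the scalar product making the
  \<open>X j\<close>, \<open>Y j\<close> orthonormal.\<close>

definition inner_H :: "'n::finite heis \<Rightarrow> 'n heis \<Rightarrow> real" where
  "inner_H v w = fst v \<bullet> fst w + fst (snd v) \<bullet> fst (snd w)"

definition hpart :: "'n::finite heis \<Rightarrow> 'n heis \<Rightarrow> 'n heis" where
  "hpart p v = (\<Sum>j\<in>UNIV. (fst v $ j) *\<^sub>R Xf j p + (fst (snd v) $ j) *\<^sub>R Yf j p)"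

lemma inner_H_orthonormal:
  "inner_H (Xf j p) (Xf k p) = (if j = k then 1 else 0)"
  "inner_H (Yf j p) (Yf k p) = (if j = k then 1 else 0)"
  "inner_H (Xf j p) (Yf k p) = 0"
  by (simp_all add: inner_H_def Xf_def Yf_def inner_axis_axis)

lemma fst_hpart: "fst (hpart p v) = fst v"
  by (simp add: hpart_def fst_sum Xf_def Yf_def vec_eq_iff axis_def if_distrib cong: if_cong)

lemma fst_snd_hpart: "fst (snd (hpart p v)) = fst (snd v)"
  by (simp add: hpart_def fst_sum snd_sum Xf_def Yf_def vec_eq_iff axis_def if_distrib cong: if_cong)

lemma hpart_decomp: "v = hpart p v + (snd (snd v) - snd (snd (hpart p v))) *\<^sub>R Tf p"
  by (simp add: prod_eq_iff fst_hpart fst_snd_hpart Tf_def)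

lemma hpart_in_hlayer: "hpart p v \<in> hlayer p"
  unfolding hpart_def hlayer_def
  by (intro span_sum span_add span_scale span_base) auto

subsection \<open>P-differentiability and \<open>\<bbbH>\<close>-regular surfaces\<close>

definition P_differentiable_at :: "('n::finite heis \<Rightarrow> real) \<Rightarrow> 'n heis \<Rightarrow> bool" where
  "P_differentiable_at f p0 \<longleftrightarrow>
     (\<exists>L. (\<forall>p q. L (hmul p q) = L p + L q) \<and>
          (\<forall>\<rho>>0. \<forall>p. L (dil \<rho> p) = \<rho> * L p) \<and>
          (\<forall>K. compact K \<longrightarrow>
             uniform_limit K (\<lambda>\<rho> p. (f (hmul p0 (dil \<rho> p)) - f p0) / \<rho>) L (at_right 0)))"

text \<open>The integral curve of \<open>X j\<close> (of \<open>Y j\<close>) through \<open>p\<close> is the line \<open>p + s X j p\<close>, so the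
  derivative along the field is a derivative along this line.\<close>

definition along :: "('n::finite heis \<Rightarrow> 'n heis) \<Rightarrow> ('n heis \<Rightarrow> real) \<Rightarrow> 'n heis \<Rightarrow> real" where
  "along V f p = deriv (\<lambda>s::real. f (p + s *\<^sub>R V p)) 0"

definition hgrad :: "('n::finite heis \<Rightarrow> real) \<Rightarrow> 'n heis \<Rightarrow> 'n heis" where
  "hgrad f p = (\<Sum>j\<in>UNIV. along (Xf j) f p *\<^sub>R Xf j p + along (Yf j) f p *\<^sub>R Yf j p)"

definition C1_H_on :: "'n::finite heis set \<Rightarrow> ('n heis \<Rightarrow> real) \<Rightarrow> bool" where
  "C1_H_on U f \<longleftrightarrow> continuous_on U f \<and> (\<forall>p\<in>U. P_differentiable_at f p) \<and>
     continuous_on U (hgrad f)"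

definition H_regular_surface :: "'n::finite heis set \<Rightarrow> bool" where
  "H_regular_surface S \<longleftrightarrow>
     (\<forall>p\<in>S. \<exists>U f. open U \<and> p \<in> U \<and> C1_H_on U f \<and> S \<inter> U = {q \<in> U. f q = 0} \<and>
        (\<forall>q\<in>U. hgrad f q \<noteq> 0))"

subsection \<open>Euclidean surfaces, tangent vectors and the characteristic set\<close>

definition C1_surface :: "'n::finite heis set \<Rightarrow> bool" where
  "C1_surface S \<longleftrightarrow>
     (\<forall>p\<in>S. \<exists>U g grad. open U \<and> p \<in> U \<and> (\<forall>q\<in>U. GDERIV g q :> grad q) \<and>
        continuous_on U grad \<and> S \<inter> U = {q \<in> U. g q = 0} \<and> (\<forall>q\<in>U. grad q \<noteq> 0))"

definition tangent_space :: "'n::finite heis set \<Rightarrow> 'n heis \<Rightarrow> 'n heis set" where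
  "tangent_space S p =
     {v. \<exists>\<gamma> \<epsilon>. \<epsilon> > 0 \<and> \<gamma> C1_differentiable_on {-\<epsilon><..<\<epsilon>} \<and> \<gamma> ` {-\<epsilon><..<\<epsilon>} \<subseteq> S \<and>
        \<gamma> 0 = p \<and> (\<gamma> has_vector_derivative v) (at (0::real))}"

definition tangent_fields :: "'n::finite heis set \<Rightarrow> ('n heis \<Rightarrow> 'n heis) set" where
  "tangent_fields S = {w. continuous_on S w \<and> (\<forall>p\<in>S. w p \<in> tangent_space S p)}"

definition char_set :: "'n::finite heis set \<Rightarrow> 'n heis set" where
  "char_set S = {p \<in> S. tangent_space S p \<subseteq> hlayer p}"

subsection \<open>\<open>\<bbbH>\<close>-orthogonality and \<open>\<bbbH>\<close>-orientability\<close>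

text \<open>For a tangent field \<open>w\<close>, the restriction of \<open>w\<close> to the horizontal layer can be read as the
  horizontal component \<open>hpart p (w p)\<close> of \<open>w\<close>, for every tangent \<open>w\<close> (first definition), or as
  letting only those tangent \<open>w\<close> count that lie in the horizontal layer (second definition).
  Under the first reading a nonzero horizontal vector at \<open>p\<close> is orthogonal to the surface only
  where \<open>T\<close> is tangent to it; under the second one the orthogonal horizontal vectors at \<open>p\<close> are the
  multiples of the local horizontal normal.\<close>

definition H_orthogonal :: "('n::finite heis \<Rightarrow> 'n heis) \<Rightarrow> 'n heis set \<Rightarrow> bool" where
  "H_orthogonal v S \<longleftrightarrow>
     (\<forall>w\<in>tangent_fields S. \<forall>p\<in>S. inner_H (v p) (hpart p (w p)) = 0)"

definition H_orthogonal_hor :: "('n::finite heis \<Rightarrow> 'n heis) \<Rightarrow> 'n heis set \<Rightarrow> bool" where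
  "H_orthogonal_hor v S \<longleftrightarrow>
     (\<forall>w\<in>tangent_fields S. (\<forall>p\<in>S. w p \<in> hlayer p) \<longrightarrow> (\<forall>p\<in>S. inner_H (v p) (w p) = 0))"

definition H_orientable :: "'n::finite heis set \<Rightarrow> bool" where
  "H_orientable S \<longleftrightarrow> C1_surface S \<and> char_set S = {} \<and>
     (\<exists>nH. continuous_on S nH \<and> (\<forall>p\<in>S. nH p \<in> hlayer p \<and> nH p \<noteq> 0) \<and> H_orthogonal nH S)"

definition H_orientable_hor :: "'n::finite heis set \<Rightarrow> bool" where
  "H_orientable_hor S \<longleftrightarrow> C1_surface S \<and> char_set S = {} \<and>
     (\<exists>nH. continuous_on S nH \<and> (\<forall>p\<in>S. nH p \<in> hlayer p \<and> nH p \<noteq> 0) \<and> H_orthogonal_hor nH S)"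

end

theory Submission
  imports Defs
begin

text \<open>Left translations and dilations are both of the form \<open>F p = a * \<delta>\<^sub>s p\<close> with \<open>s \<noteq> 0\<close>, and the
  inverse of such a map is again one, so all claims follow if each property of \<open>S\<close> passes to the
  preimage \<open>F -` S\<close>. Defining functions are pulled back to \<open>f \<circ> F\<close>. The map \<open>F\<close> is affine, and its
  linear part sends \<open>X j\<close>, \<open>Y j\<close> at \<open>p\<close> to \<open>s X j\<close>, \<open>s Y j\<close> at \<open>F p\<close>; it therefore preserves horizontal
  layers, and the field with the coordinates of \<open>n \<circ> F\<close> in the frame \<open>X j\<close>, \<open>Y j\<close> is a horizontal
  normal of \<open>F -` S\<close> whenever \<open>n\<close> is one of \<open>S\<close>.\<close>

subsection \<open>Preimages of surfaces under \<open>C\<^sup>1\<close> maps\<close>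

locale C1_map =
  fixes F :: "'m::finite heis \<Rightarrow> 'n::finite heis"
    and F' :: "'m heis \<Rightarrow> 'm heis \<Rightarrow>\<^sub>L 'n heis"
  assumes map_has_derivative: "(F has_derivative F' p) (at p)"
    and continuous_on_derivative: "continuous_on UNIV F'"
begin

lemma linear_derivative: "linear (F' p)"
  by (rule bounded_linear.linear[OF blinfun.bounded_linear_right])

lemma continuous_on_map: "continuous_on A F"
  by (meson map_has_derivative has_derivative_continuous continuous_at_imp_continuous_on)

lemma open_vimage_map: "open U \<Longrightarrow> open (F -` U)"
  by (simp add: continuous_on_map open_vimage)

lemma continuous_on_comp_map: "continuous_on U f \<Longrightarrow> continuous_on (F -` U) (\<lambda>p. f (F p))"
  by (rule continuous_on_compose2[OF _ continuous_on_map]) auto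

lemma continuous_on_derivative_apply:
  assumes "continuous_on A f" and "continuous_on A v"
  shows "continuous_on A (\<lambda>x. F' (f x) (v x))"
  using assms(2) continuous_on_compose2[OF continuous_on_derivative assms(1)]
  by (intro blinfun.continuous_on) auto

lemma tangent_space_pushforward:
  assumes "v \<in> tangent_space S p" and "F ` S \<subseteq> S'"
  shows "F' p v \<in> tangent_space S' (F p)"
proof -
  obtain \<gamma> \<epsilon> where \<epsilon>: "\<epsilon> > 0" and \<gamma>: "\<gamma> C1_differentiable_on {-\<epsilon><..<\<epsilon>}"
    and curve_in_S: "\<gamma> ` {-\<epsilon><..<\<epsilon>} \<subseteq> S" and start: "\<gamma> 0 = p"
    and v: "(\<gamma> has_vector_derivative v) (at (0::real))"
    using assms(1) unfolding tangent_space_def by blast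
  have chain: "(F \<circ> \<gamma> has_vector_derivative F' (\<gamma> x) u) (at x)"
    if "(\<gamma> has_vector_derivative u) (at x)" for u x
    by (rule vector_derivative_diff_chain_within[OF that])
       (rule has_derivative_at_withinI[OF map_has_derivative])
  obtain D where D: "\<forall>x\<in>{-\<epsilon><..<\<epsilon>}. (\<gamma> has_vector_derivative D x) (at x)"
    and continuous_D: "continuous_on {-\<epsilon><..<\<epsilon>} D"
    using \<gamma> unfolding C1_differentiable_on_def by blast
  have "continuous_on {-\<epsilon><..<\<epsilon>} (\<lambda>x. F' (\<gamma> x) (D x))"
    by (intro continuous_on_derivative_apply C1_differentiable_imp_continuous_on \<gamma> continuous_D)
  then have "F \<circ> \<gamma> C1_differentiable_on {-\<epsilon><..<\<epsilon>}"
    unfolding C1_differentiable_on_def using D chain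
    by (intro exI[of _ "\<lambda>x. F' (\<gamma> x) (D x)"]) auto
  moreover have "(F \<circ> \<gamma>) ` {-\<epsilon><..<\<epsilon>} \<subseteq> S'"
    using curve_in_S assms(2) by auto
  ultimately show ?thesis
    unfolding tangent_space_def using \<epsilon> start chain[OF v] by (auto simp: o_def)
qed

lemma tangent_fields_pushforward:
  assumes "w \<in> tangent_fields S" and "F ` S \<subseteq> S'"
    and "continuous_on S' G" and "G ` S' \<subseteq> S" and "\<And>q. q \<in> S' \<Longrightarrow> F (G q) = q"
  shows "(\<lambda>q. F' (G q) (w (G q))) \<in> tangent_fields S'"
proof -
  have w: "continuous_on S w" "\<And>p. p \<in> S \<Longrightarrow> w p \<in> tangent_space S p"
    using assms(1) by (auto simp: tangent_fields_def)
  have "continuous_on S' (\<lambda>q. F' (G q) (w (G q)))"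
    by (rule continuous_on_derivative_apply[OF assms(3)
        continuous_on_compose2[OF w(1) assms(3,4)]])
  moreover have "F' (G q) (w (G q)) \<in> tangent_space S' q" if "q \<in> S'" for q
  proof -
    have "G q \<in> S"
      using assms(4) that by blast
    from tangent_space_pushforward[OF w(2)[OF this] assms(2)] show ?thesis
      by (simp add: assms(5)[OF that])
  qed
  ultimately show ?thesis
    by (simp add: tangent_fields_def)
qed

lemma GDERIV_comp_map:
  assumes "GDERIV g (F p) :> u"
  shows "GDERIV (g \<circ> F) p :> adjoint (F' p) u"
  using diff_chain_at[OF map_has_derivative assms[unfolded gderiv_def]]
  by (simp add: gderiv_def o_def adjoint_works linear_derivative)

lemma continuous_on_adjoint_derivative:
  assumes "continuous_on A u"
  shows "continuous_on A (\<lambda>p. adjoint (F' p) (u p))"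
proof -
  have adjoint_eq: "adjoint (F' p) y = (\<Sum>b\<in>Basis. (F' p b \<bullet> y) *\<^sub>R b)" for p y
    by (subst euclidean_representation[symmetric])
       (simp add: inner_commute[of "adjoint _ _"] adjoint_works linear_derivative)
  show ?thesis
    unfolding adjoint_eq by (intro continuous_intros continuous_on_derivative_apply assms)
qed

lemma C1_surface_vimage:
  assumes "C1_surface S" and surj: "\<And>p. surj (F' p)"
  shows "C1_surface (F -` S)"
  unfolding C1_surface_def
proof
  fix p assume "p \<in> F -` S"
  then have "F p \<in> S" by simp
  from bspec[OF assms(1)[unfolded C1_surface_def] this]
  obtain U g grad where U: "open U" "F p \<in> U" and g: "\<forall>q\<in>U. GDERIV g q :> grad q"
    and cont: "continuous_on U grad" and zero_set: "S \<inter> U = {q \<in> U. g q = 0}"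
    and nonzero: "\<forall>q\<in>U. grad q \<noteq> 0"
    by (elim exE conjE) (rule that)
  define grad' where "grad' = (\<lambda>q. adjoint (F' q) (grad (F q)))"
  show "\<exists>U g grad. open U \<and> p \<in> U \<and> (\<forall>q\<in>U. GDERIV g q :> grad q) \<and>
      continuous_on U grad \<and> F -` S \<inter> U = {q \<in> U. g q = 0} \<and> (\<forall>q\<in>U. grad q \<noteq> 0)"
  proof (intro exI conjI ballI)
    show "open (F -` U)" and "p \<in> F -` U"
      using U by (simp_all add: open_vimage_map)
    show "GDERIV (g \<circ> F) q :> grad' q" if "q \<in> F -` U" for q
      using g that by (auto simp: grad'_def intro: GDERIV_comp_map)
    show "continuous_on (F -` U) grad'"
      unfolding grad'_def by (intro continuous_on_adjoint_derivative continuous_on_comp_map cont)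
    show "F -` S \<inter> F -` U = {q \<in> F -` U. (g \<circ> F) q = 0}"
      unfolding o_def using zero_set by blast
    show "grad' q \<noteq> 0" if "q \<in> F -` U" for q
    proof
      assume zero: "grad' q = 0"
      obtain v where "grad (F q) = F' q v"
        using surj[of q] by (rule surjE)
      then have "grad (F q) \<bullet> grad (F q) = v \<bullet> grad' q"
        by (simp add: grad'_def adjoint_works linear_derivative)
      then show False
        using nonzero that zero by simp
    qed
  qed
qed

end

subsection \<open>The Heisenberg group and its horizontal layers\<close>

lemma hmul_eq:
  "hmul p q = (fst p + fst q, fst (snd p) + fst (snd q),
     snd (snd p) + snd (snd q) + (fst p \<bullet> fst (snd q) - fst (snd p) \<bullet> fst q) / 2)"
  by (simp add: hmul_def inner_vec_def sum_subtractf split_beta)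

lemma dil_eq: "dil r p = (r *\<^sub>R fst p, r *\<^sub>R fst (snd p), r\<^sup>2 * snd (snd p))"
  by (simp add: dil_def split_beta)

lemma hpart_eq:
  "hpart p v = (fst v, fst (snd v), (fst p \<bullet> fst (snd v) - fst (snd p) \<bullet> fst v) / 2)"
proof -
  have "snd (snd (hpart p v)) = (fst p \<bullet> fst (snd v) - fst (snd p) \<bullet> fst v) / 2"
    by (simp add: hpart_def snd_sum Xf_def Yf_def inner_vec_def sum_subtractf[symmetric]
        sum_divide_distrib field_simps)
  then show ?thesis
    by (simp add: prod_eq_iff fst_hpart fst_snd_hpart)
qed

lemma hmul_assoc: "hmul (hmul p q) u = hmul p (hmul q u)"
  by (simp add: hmul_eq inner_simps field_simps)

lemma hmul_0 [simp]: "hmul 0 p = p" "hmul p 0 = p"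
  by (simp_all add: hmul_eq)

lemma hmul_minus [simp]: "hmul p (- p) = 0" "hmul (- p) p = 0"
  by (simp_all add: hmul_eq inner_commute prod_eq_iff)

lemma dil_hmul: "dil r (hmul p q) = hmul (dil r p) (dil r q)"
  by (simp add: hmul_eq dil_eq prod_eq_iff algebra_simps power2_eq_square diff_divide_distrib)

lemma dil_dil: "dil r (dil s p) = dil (r * s) p"
  by (simp add: dil_eq power_mult_distrib)

lemma dil_one [simp]: "dil 1 p = p"
  by (simp add: dil_eq)

lemma dil_minus: "dil s (- p) = - dil s p"
  by (simp add: dil_eq)

lemma continuous_on_dil: "continuous_on A (dil s)"
  unfolding dil_eq by (intro continuous_intros)

lemma Xf_in_hlayer: "Xf j p \<in> hlayer p"
  unfolding hlayer_def by (intro span_base) auto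

lemma Yf_in_hlayer: "Yf j p \<in> hlayer p"
  unfolding hlayer_def by (intro span_base) auto

lemma hlayer_iff_hpart: "v \<in> hlayer p \<longleftrightarrow> hpart p v = v"
proof
  assume "v \<in> hlayer p"
  then show "hpart p v = v"
    unfolding hlayer_def hpart_eq
    by (induction rule: span_induct_alt)
       (auto simp: Xf_def Yf_def inner_axis inner_simps field_simps prod_eq_iff)
qed (metis hpart_in_hlayer)

lemma continuous_on_hpart: "continuous_on A v \<Longrightarrow> continuous_on A (\<lambda>p. hpart p (v p))"
  unfolding hpart_eq by (intro continuous_intros) auto

lemma hpart_neq_0:
  assumes "v \<in> hlayer q" and "v \<noteq> 0"
  shows "hpart p v \<noteq> 0"
proof -
  have "hpart p v = 0 \<longleftrightarrow> hpart q v = 0"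
    by (auto simp: hpart_eq prod_eq_iff)
  then show ?thesis
    using assms by (simp add: hlayer_iff_hpart)
qed

lemma inner_H_hpart [simp]:
  "inner_H (hpart p v) w = inner_H v w" "inner_H v (hpart p w) = inner_H v w"
  by (simp_all add: inner_H_def hpart_eq)

lemma hlayer_scaleR: "v \<in> hlayer p \<Longrightarrow> c *\<^sub>R v \<in> hlayer p"
  by (simp add: hlayer_def span_scale)

subsection \<open>Horizontal derivatives\<close>

lemma hmul_dil_horizontal:
  assumes "v \<in> hlayer p"
  shows "hmul p (dil \<rho> (fst v, fst (snd v), 0)) = p + \<rho> *\<^sub>R v"
proof -
  have vertical: "snd (snd v) = (fst p \<bullet> fst (snd v) - fst (snd p) \<bullet> fst v) / 2"
    using assms by (simp add: hlayer_iff_hpart hpart_eq prod_eq_iff)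
  show ?thesis
    by (simp add: hmul_eq dil_eq prod_eq_iff vertical algebra_simps)
qed

text \<open>The operator \<^const>\<open>deriv\<close> in \<^const>\<open>along\<close> has an arbitrary value where the derivative does not
  exist, so its chain rule needs the existence of the derivative.\<close>

lemma P_differentiable_imp_horizontal_derivative:
  assumes "P_differentiable_at f p" and "v \<in> hlayer p"
  obtains D where "((\<lambda>h. f (p + h *\<^sub>R v)) has_real_derivative D) (at 0)"
proof -
  obtain L where L_hmul: "\<forall>p q. L (hmul p q) = L p + L q"
    and lim: "\<forall>K. compact K \<longrightarrow>
      uniform_limit K (\<lambda>\<rho> q. (f (hmul p (dil \<rho> q)) - f p) / \<rho>) L (at_right 0)"
    using assms(1) unfolding P_differentiable_at_def by blast
  have pointwise: "((\<lambda>\<rho>. (f (hmul p (dil \<rho> q)) - f p) / \<rho>) \<longlongrightarrow> L q) (at_right 0)" for q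
    using tendsto_uniform_limitI[OF lim[rule_format, of "{q}"]] by simp
  define u where "u = (fst v, fst (snd v), 0::real)"
  have "L 0 = 0"
    using L_hmul[rule_format, of 0 0] by simp
  then have Lminus: "L (- u) = - L u"
    using L_hmul[rule_format, of u "- u"] by simp
  have right: "hmul p (dil h u) = p + h *\<^sub>R v" for h
    unfolding u_def by (rule hmul_dil_horizontal[OF assms(2)])
  have left: "hmul p (dil h (- u)) = p - h *\<^sub>R v" for h
    using hmul_dil_horizontal[OF hlayer_scaleR[OF assms(2), of "-1"], of h] by (simp add: u_def)
  have "((\<lambda>h. (f (p + h *\<^sub>R v) - f p) / h) \<longlongrightarrow> L u) (at_right 0)"
    using pointwise[of u] by (simp add: right)
  moreover have "((\<lambda>h. (f (p + h *\<^sub>R v) - f p) / h) \<longlongrightarrow> L u) (at_left 0)"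
    using tendsto_minus[OF pointwise[of "- u"]]
    by (simp add: at_left_minus[of 0] filterlim_filtermap left Lminus)
  ultimately have "((\<lambda>h. f (p + h *\<^sub>R v)) has_real_derivative L u) (at 0)"
    by (simp add: DERIV_def filterlim_split_at)
  then show ?thesis by (rule that)
qed

lemma hgrad_in_hlayer: "hgrad f p \<in> hlayer p"
  unfolding hgrad_def hlayer_def by (intro span_sum span_add span_scale span_base) auto

lemma hgrad_nth:
  "fst (hgrad f p) $ j = along (Xf j) f p"
  "fst (snd (hgrad f p)) $ j = along (Yf j) f p"
proof -
  have "hgrad f p = hpart p (\<chi> j. along (Xf j) f p, \<chi> j. along (Yf j) f p, 0)"
    by (simp add: hgrad_def hpart_def)
  then show "fst (hgrad f p) $ j = along (Xf j) f p"
    "fst (snd (hgrad f p)) $ j = along (Yf j) f p"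
    by (simp_all add: fst_hpart fst_snd_hpart)
qed

subsection \<open>Similarities of the Heisenberg group\<close>

definition hsim :: "'n::finite heis \<Rightarrow> real \<Rightarrow> 'n heis \<Rightarrow> 'n heis" where
  "hsim a s p = hmul a (dil s p)"

definition hsim_deriv :: "'n::finite heis \<Rightarrow> real \<Rightarrow> 'n heis \<Rightarrow> 'n heis" where
  "hsim_deriv a s v = (s *\<^sub>R fst v, s *\<^sub>R fst (snd v),
     s\<^sup>2 * snd (snd v) + s / 2 * (fst a \<bullet> fst (snd v) - fst (snd a) \<bullet> fst v))"

lemma hsim_hmul: "hsim a s (hmul p q) = hmul (hsim a s p) (dil s q)"
  by (simp add: hsim_def dil_hmul hmul_assoc)

lemma linear_hsim_deriv: "linear (hsim_deriv a s)"
  by (rule linearI) (simp_all add: hsim_deriv_def prod_eq_iff inner_simps algebra_simps)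

lemma hsim_add: "hsim a s (p + v) = hsim a s p + hsim_deriv a s v"
  by (simp add: hsim_def hsim_deriv_def hmul_eq dil_eq prod_eq_iff inner_simps field_simps)

lemma hsim_inverse:
  assumes "s \<noteq> 0"
  obtains b t where "t \<noteq> 0"
    and "\<And>p. hsim b t (hsim a s p) = p" and "\<And>p. hsim a s (hsim b t p) = p"
    and "\<And>v. hsim_deriv a s (hsim_deriv b t v) = v"
proof
  let ?b = "dil (1 / s) (- a)" and ?t = "1 / s"
  show "?t \<noteq> 0" and "hsim ?b ?t (hsim a s p) = p" for p
    using assms by (simp_all add: hsim_def dil_hmul dil_dil dil_minus hmul_assoc[symmetric])
  show right_inverse: "hsim a s (hsim ?b ?t p) = p" for p
    using assms by (simp add: hsim_def dil_hmul dil_dil dil_minus hmul_assoc[symmetric])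
  have "hsim a s (hsim ?b ?t 0 + hsim_deriv ?b ?t v) = v" for v
    by (simp only: hsim_add[symmetric] right_inverse add_0)
  then show "hsim_deriv a s (hsim_deriv ?b ?t v) = v" for v
    by (simp only: hsim_add right_inverse add_0)
qed

interpretation hsim: C1_map "hsim a s" "\<lambda>_. Blinfun (hsim_deriv a s)"
  rewrites "blinfun_apply (Blinfun (hsim_deriv a s)) = hsim_deriv a s"
  for a :: "'n::finite heis" and s
proof -
  have bounded: "bounded_linear (hsim_deriv a s)"
    by (simp add: linear_hsim_deriv linear_conv_bounded_linear[symmetric])
  then show apply_eq: "blinfun_apply (Blinfun (hsim_deriv a s)) = hsim_deriv a s"
    by (rule bounded_linear_Blinfun_apply)
  have "((\<lambda>p. hsim a s 0 + hsim_deriv a s p) has_derivative hsim_deriv a s) (at p)" for p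
    by (auto intro!: derivative_eq_intros bounded_linear_imp_has_derivative[OF bounded])
  then have "(hsim a s has_derivative hsim_deriv a s) (at p)" for p
    by (simp add: hsim_add[symmetric])
  then show "C1_map (hsim a s) (\<lambda>_. Blinfun (hsim_deriv a s))"
    by unfold_locales (simp_all add: apply_eq)
qed

lemma hsim_deriv_hpart: "hsim_deriv a s (hpart p v) = hpart (hsim a s p) (hsim_deriv a s v)"
  by (simp add: hpart_eq hsim_deriv_def hsim_def hmul_eq dil_eq inner_simps power2_eq_square
      field_simps)

lemma hsim_deriv_in_hlayer: "v \<in> hlayer p \<Longrightarrow> hsim_deriv a s v \<in> hlayer (hsim a s p)"
  by (metis hlayer_iff_hpart hsim_deriv_hpart)

lemma hsim_deriv_Xf: "hsim_deriv a s (Xf j p) = s *\<^sub>R Xf j (hsim a s p)"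
  by (simp add: hsim_deriv_def Xf_def hsim_def hmul_eq dil_eq inner_axis power2_eq_square
      algebra_simps)

lemma hsim_deriv_Yf: "hsim_deriv a s (Yf j p) = s *\<^sub>R Yf j (hsim a s p)"
  by (simp add: hsim_deriv_def Yf_def hsim_def hmul_eq dil_eq inner_axis power2_eq_square
      algebra_simps)

lemma inner_H_hsim_deriv_right: "inner_H v (hsim_deriv a s w) = s * inner_H v w"
  by (simp add: inner_H_def hsim_deriv_def algebra_simps)

subsection \<open>Preimages of \<open>\<bbbH>\<close>-regular surfaces under similarities\<close>

lemma P_differentiable_comp_hsim:
  assumes "P_differentiable_at f (hsim a s p)"
  shows "P_differentiable_at (f \<circ> hsim a s) p"
proof -
  obtain L where L_hmul: "\<forall>p q. L (hmul p q) = L p + L q"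
    and L_dil: "\<forall>\<rho>>0. \<forall>p. L (dil \<rho> p) = \<rho> * L p"
    and lim: "\<forall>K. compact K \<longrightarrow> uniform_limit K
      (\<lambda>\<rho> q. (f (hmul (hsim a s p) (dil \<rho> q)) - f (hsim a s p)) / \<rho>) L (at_right 0)"
    using assms unfolding P_differentiable_at_def by (elim exE conjE) (rule that)
  have "uniform_limit K (\<lambda>\<rho> q. ((f \<circ> hsim a s) (hmul p (dil \<rho> q)) - (f \<circ> hsim a s) p) / \<rho>)
      (L \<circ> dil s) (at_right 0)" if "compact K" for K
  proof -
    have "compact (dil s ` K)"
      by (rule compact_continuous_image[OF continuous_on_dil that])
    from uniform_limit_compose'[OF lim[rule_format, OF this], of "dil s" K] show ?thesis
      by (simp add: o_def hsim_hmul dil_dil mult.commute)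
  qed
  moreover have "(L \<circ> dil s) (dil \<rho> q) = \<rho> * (L \<circ> dil s) q" if "\<rho> > 0" for \<rho> q
    using L_dil[rule_format, OF that, of "dil s q"] by (simp add: dil_dil mult.commute)
  ultimately show ?thesis
    unfolding P_differentiable_at_def
    by (intro exI[of _ "L \<circ> dil s"]) (simp add: dil_hmul L_hmul)
qed

lemma along_comp_hsim:
  assumes "P_differentiable_at f (hsim a s p)" and "V (hsim a s p) \<in> hlayer (hsim a s p)"
    and V: "hsim_deriv a s (V p) = s *\<^sub>R V (hsim a s p)"
  shows "along V (f \<circ> hsim a s) p = s * along V f (hsim a s p)"
proof -
  define g where "g = (\<lambda>h. f (hsim a s p + h *\<^sub>R V (hsim a s p)))"
  obtain D where D: "(g has_real_derivative D) (at 0)"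
    unfolding g_def by (rule P_differentiable_imp_horizontal_derivative[OF assms(1,2)])
  have "((\<lambda>h. g (h * s)) has_real_derivative D * s) (at 0)"
    by (rule DERIV_chain2[of g D "\<lambda>h. h * s" 0 s UNIV])
      (use D in \<open>auto intro!: derivative_eq_intros\<close>)
  moreover have "(f \<circ> hsim a s) (p + h *\<^sub>R V p) = g (h * s)" for h
    by (simp add: g_def hsim_add linear_scale[OF linear_hsim_deriv] V)
  ultimately show ?thesis
    using D by (simp add: along_def DERIV_imp_deriv g_def[symmetric])
qed

lemma hgrad_comp_hsim:
  assumes "P_differentiable_at f (hsim a s p)"
  shows "hgrad (f \<circ> hsim a s) p = hpart p (s *\<^sub>R hgrad f (hsim a s p))"
proof -
  have "along (Xf j) (f \<circ> hsim a s) p = s * along (Xf j) f (hsim a s p)"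
    "along (Yf j) (f \<circ> hsim a s) p = s * along (Yf j) f (hsim a s p)" for j
    by (intro along_comp_hsim assms Xf_in_hlayer Yf_in_hlayer hsim_deriv_Xf hsim_deriv_Yf)+
  then show ?thesis
    by (simp add: hgrad_def[of "f \<circ> hsim a s"] hpart_def hgrad_nth)
qed

lemma C1_H_on_comp_hsim:
  assumes "C1_H_on U f"
  shows "C1_H_on (hsim a s -` U) (f \<circ> hsim a s)"
proof -
  have f: "continuous_on U f" "continuous_on U (hgrad f)"
    and P: "\<And>q. q \<in> U \<Longrightarrow> P_differentiable_at f q"
    using assms by (auto simp: C1_H_on_def)
  have "continuous_on (hsim a s -` U) (\<lambda>p. hpart p (s *\<^sub>R hgrad f (hsim a s p)))"
    by (intro continuous_on_hpart continuous_intros hsim.continuous_on_comp_map f)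
  then have "continuous_on (hsim a s -` U) (hgrad (f \<circ> hsim a s))"
    by (rule continuous_on_eq) (simp add: hgrad_comp_hsim P)
  moreover have "continuous_on (hsim a s -` U) (f \<circ> hsim a s)"
    unfolding o_def by (intro hsim.continuous_on_comp_map f)
  ultimately show ?thesis
    by (simp add: C1_H_on_def P_differentiable_comp_hsim P)
qed

lemma H_regular_surface_vimage_hsim:
  assumes "s \<noteq> 0" and "H_regular_surface S"
  shows "H_regular_surface (hsim a s -` S)"
  unfolding H_regular_surface_def
proof
  let ?F = "hsim a s"
  fix p assume "p \<in> ?F -` S"
  then have "?F p \<in> S" by simp
  from bspec[OF assms(2)[unfolded H_regular_surface_def] this]
  obtain U f where U: "open U" "?F p \<in> U" and f: "C1_H_on U f"
    and zero_set: "S \<inter> U = {q \<in> U. f q = 0}" and nonzero: "\<forall>q\<in>U. hgrad f q \<noteq> 0"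
    by (elim exE conjE) (rule that)
  show "\<exists>U f. open U \<and> p \<in> U \<and> C1_H_on U f \<and> ?F -` S \<inter> U = {q \<in> U. f q = 0} \<and>
      (\<forall>q\<in>U. hgrad f q \<noteq> 0)"
  proof (intro exI conjI ballI)
    show "open (?F -` U)" and "p \<in> ?F -` U"
      using U by (simp_all add: hsim.open_vimage_map)
    show "C1_H_on (?F -` U) (f \<circ> ?F)"
      by (rule C1_H_on_comp_hsim[OF f])
    show "?F -` S \<inter> ?F -` U = {q \<in> ?F -` U. (f \<circ> ?F) q = 0}"
      unfolding o_def using zero_set by blast
    show "hgrad (f \<circ> ?F) q \<noteq> 0" if "q \<in> ?F -` U" for q
    proof -
      have "hgrad (f \<circ> ?F) q = hpart q (s *\<^sub>R hgrad f (?F q))"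
        using f that by (intro hgrad_comp_hsim) (simp add: C1_H_on_def)
      also have "\<dots> \<noteq> 0"
        using assms(1) nonzero that
        by (intro hpart_neq_0[OF hlayer_scaleR[OF hgrad_in_hlayer]]) simp
      finally show ?thesis .
    qed
  qed
qed

subsection \<open>Preimages of \<open>\<bbbH>\<close>-orientable surfaces under similarities\<close>

lemma C1_surface_vimage_hsim:
  assumes "s \<noteq> 0" and "C1_surface S"
  shows "C1_surface (hsim a s -` S)"
proof (rule hsim.C1_surface_vimage[OF assms(2)])
  show "surj (hsim_deriv a s)"
    using hsim_inverse[OF assms(1)] by (metis surjI)
qed

lemma char_set_vimage_hsim:
  assumes "s \<noteq> 0" and "char_set S = {}"
  shows "char_set (hsim a s -` S) = {}"
proof -
  obtain b t where left: "\<And>p. hsim b t (hsim a s p) = p"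
    and right: "\<And>p. hsim a s (hsim b t p) = p"
    and right_deriv: "\<And>v. hsim_deriv a s (hsim_deriv b t v) = v"
    using hsim_inverse[OF assms(1)] by metis
  have "hsim a s p \<in> char_set S" if "p \<in> char_set (hsim a s -` S)" for p
  proof -
    have p: "hsim a s p \<in> S" "tangent_space (hsim a s -` S) p \<subseteq> hlayer p"
      using that by (auto simp: char_set_def)
    have "v \<in> hlayer (hsim a s p)" if v: "v \<in> tangent_space S (hsim a s p)" for v
    proof -
      have "hsim b t ` S \<subseteq> hsim a s -` S"
        by (auto simp: right)
      from hsim.tangent_space_pushforward[OF v this] have "hsim_deriv b t v \<in> hlayer p"
        using p(2) by (auto simp: left)
      then show ?thesis
        using hsim_deriv_in_hlayer by (metis right_deriv)
    qed
    with p(1) show ?thesis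
      by (auto simp: char_set_def)
  qed
  with assms(2) show ?thesis by auto
qed

definition horizontal_tangent_fields :: "'n::finite heis set \<Rightarrow> ('n heis \<Rightarrow> 'n heis) set" where
  "horizontal_tangent_fields S = {w \<in> tangent_fields S. \<forall>p\<in>S. w p \<in> hlayer p}"

definition H_normal_field ::
    "('n::finite heis \<Rightarrow> 'n heis) set \<Rightarrow> 'n heis set \<Rightarrow> ('n heis \<Rightarrow> 'n heis) \<Rightarrow> bool" where
  "H_normal_field W S v \<longleftrightarrow> continuous_on S v \<and> (\<forall>p\<in>S. v p \<in> hlayer p \<and> v p \<noteq> 0) \<and>
     (\<forall>w\<in>W. \<forall>p\<in>S. inner_H (v p) (w p) = 0)"

definition H_orientable_wrt :: "('n::finite heis \<Rightarrow> 'n heis) set \<Rightarrow> 'n heis set \<Rightarrow> bool" where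
  "H_orientable_wrt W S \<longleftrightarrow> C1_surface S \<and> char_set S = {} \<and> (\<exists>v. H_normal_field W S v)"

lemma H_orientable_iff: "H_orientable S \<longleftrightarrow> H_orientable_wrt (tangent_fields S) S"
  by (simp add: H_orientable_def H_orientable_wrt_def H_orthogonal_def H_normal_field_def)

lemma H_orientable_hor_iff:
  "H_orientable_hor S \<longleftrightarrow> H_orientable_wrt (horizontal_tangent_fields S) S"
  by (auto simp: H_orientable_hor_def H_orientable_wrt_def H_orthogonal_hor_def
      H_normal_field_def horizontal_tangent_fields_def)

lemma tangent_fields_vimage_hsim:
  assumes "s \<noteq> 0" and "w \<in> tangent_fields (hsim a s -` S)"
  shows "\<exists>w'\<in>tangent_fields S. \<forall>p. w' (hsim a s p) = hsim_deriv a s (w p)"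
proof -
  obtain b t where left: "\<And>p. hsim b t (hsim a s p) = p"
    and right: "\<And>p. hsim a s (hsim b t p) = p"
    using hsim_inverse[OF assms(1)] by metis
  have "(\<lambda>q. hsim_deriv a s (w (hsim b t q))) \<in> tangent_fields S"
    using assms(2) by (rule hsim.tangent_fields_pushforward)
      (auto simp: right hsim.continuous_on_map)
  then show ?thesis
    by (rule bexI[rotated]) (simp add: left)
qed

lemma horizontal_tangent_fields_vimage_hsim:
  assumes "s \<noteq> 0" and "w \<in> horizontal_tangent_fields (hsim a s -` S)"
  shows "\<exists>w'\<in>horizontal_tangent_fields S. \<forall>p. w' (hsim a s p) = hsim_deriv a s (w p)"
proof -
  have w: "w \<in> tangent_fields (hsim a s -` S)" "\<And>p. hsim a s p \<in> S \<Longrightarrow> w p \<in> hlayer p"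
    using assms(2) by (auto simp: horizontal_tangent_fields_def)
  obtain w' where w': "w' \<in> tangent_fields S" "\<forall>p. w' (hsim a s p) = hsim_deriv a s (w p)"
    by (rule bexE[OF tangent_fields_vimage_hsim[OF assms(1) w(1)]])
  have "w' q \<in> hlayer q" if "q \<in> S" for q
  proof -
    obtain p where "q = hsim a s p"
      using hsim_inverse[OF assms(1)] by metis
    then show ?thesis
      using that by (simp add: w' hsim_deriv_in_hlayer w(2))
  qed
  with w' show ?thesis
    by (intro bexI[of _ w']) (simp_all add: horizontal_tangent_fields_def)
qed

lemma H_normal_field_vimage_hsim:
  assumes "s \<noteq> 0" and "H_normal_field W S v"
    and push: "\<And>w. w \<in> W' \<Longrightarrow> \<exists>w'\<in>W. \<forall>p. w' (hsim a s p) = hsim_deriv a s (w p)"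
  shows "H_normal_field W' (hsim a s -` S) (\<lambda>p. hpart p (v (hsim a s p)))"
proof -
  have v: "continuous_on S v" "\<And>q. q \<in> S \<Longrightarrow> v q \<in> hlayer q \<and> v q \<noteq> 0"
    and orth: "\<And>w q. w \<in> W \<Longrightarrow> q \<in> S \<Longrightarrow> inner_H (v q) (w q) = 0"
    using assms(2) by (auto simp: H_normal_field_def)
  have "inner_H (v (hsim a s p)) (w p) = 0" if "w \<in> W'" "hsim a s p \<in> S" for w p
  proof -
    have "s * inner_H (v (hsim a s p)) (w p) = inner_H (v (hsim a s p)) (hsim_deriv a s (w p))"
      by (simp add: inner_H_hsim_deriv_right)
    also have "\<dots> = 0"
      using push[OF that(1)] orth[OF _ that(2)] by metis
    finally show ?thesis
      using assms(1) by simp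
  qed
  moreover have "hpart p (v (hsim a s p)) \<noteq> 0" if "hsim a s p \<in> S" for p
    using v(2)[OF that] hpart_neq_0 by blast
  moreover have "continuous_on (hsim a s -` S) (\<lambda>p. hpart p (v (hsim a s p)))"
    by (intro continuous_on_hpart hsim.continuous_on_comp_map v(1))
  ultimately show ?thesis
    by (simp add: H_normal_field_def hpart_in_hlayer)
qed

lemma H_orientable_wrt_vimage_hsim:
  assumes "s \<noteq> 0" and "H_orientable_wrt W S"
    and "\<And>w. w \<in> W' \<Longrightarrow> \<exists>w'\<in>W. \<forall>p. w' (hsim a s p) = hsim_deriv a s (w p)"
  shows "H_orientable_wrt W' (hsim a s -` S)"
proof -
  obtain v where "H_normal_field W S v"
    using assms(2) by (auto simp: H_orientable_wrt_def)
  from H_normal_field_vimage_hsim[OF assms(1) this assms(3)] show ?thesis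
    using assms(1,2)
    by (auto simp: H_orientable_wrt_def C1_surface_vimage_hsim char_set_vimage_hsim)
qed

lemma H_orientable_vimage_hsim:
  assumes "s \<noteq> 0" and "H_orientable S"
  shows "H_orientable (hsim a s -` S)"
  using assms(2) unfolding H_orientable_iff
  by (rule H_orientable_wrt_vimage_hsim[OF assms(1) _ tangent_fields_vimage_hsim[OF assms(1)]])

lemma H_orientable_hor_vimage_hsim:
  assumes "s \<noteq> 0" and "H_orientable_hor S"
  shows "H_orientable_hor (hsim a s -` S)"
  using assms(2) unfolding H_orientable_hor_iff
  by (rule H_orientable_wrt_vimage_hsim
      [OF assms(1) _ horizontal_tangent_fields_vimage_hsim[OF assms(1)]])

lemma vimage_hsim_iff:
  assumes "\<And>a s S. s \<noteq> 0 \<Longrightarrow> P S \<Longrightarrow> P (hsim a s -` S)" and "s \<noteq> 0"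
  shows "P (hsim a s -` S) \<longleftrightarrow> P S"
proof
  obtain b t where "t \<noteq> 0" and "\<And>p. hsim a s (hsim b t p) = p"
    using hsim_inverse[OF assms(2)] by metis
  moreover assume "P (hsim a s -` S)"
  ultimately show "P S"
    using assms(1)[of t "hsim a s -` S" b] by (simp add: vimage_def)
qed (rule assms(1)[OF assms(2)])

lemma H_orientable_vimage_hsim_iff:
  "s \<noteq> 0 \<Longrightarrow> H_orientable (hsim a s -` S) \<longleftrightarrow> H_orientable S"
  by (rule vimage_hsim_iff[where P = H_orientable, OF H_orientable_vimage_hsim])

lemma H_orientable_hor_vimage_hsim_iff:
  "s \<noteq> 0 \<Longrightarrow> H_orientable_hor (hsim a s -` S) \<longleftrightarrow> H_orientable_hor S"
  by (rule vimage_hsim_iff[where P = H_orientable_hor, OF H_orientable_hor_vimage_hsim])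

lemma image_eq_vimage_inverse:
  assumes "\<And>x. g (f x) = x" and "\<And>y. f (g y) = y"
  shows "f ` S = g -` S"
  by (auto simp: assms intro: rev_image_eqI)

lemma left_transl_image_eq_vimage: "left_transl p ` S = hsim (- p) 1 -` S"
  by (rule image_eq_vimage_inverse)
     (simp_all add: left_transl_def hsim_def hmul_assoc[symmetric])

lemma dil_image_eq_vimage: "r \<noteq> 0 \<Longrightarrow> dil r ` S = hsim 0 (1 / r) -` S"
  by (rule image_eq_vimage_inverse) (simp_all add: hsim_def dil_dil)

theorem proposition2p19:
  fixes pbar :: "'n::finite heis" and r :: real and S :: "'n heis set"
  assumes "r > 0"
    and "H_regular_surface S"
    and "C1_surface S"
    and "char_set S = {}"
  shows "H_regular_surface (left_transl pbar ` S) \<and> H_regular_surface (dil r ` S) \<and>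
    (H_orientable (left_transl pbar ` S) \<longleftrightarrow> H_orientable S) \<and>
    (H_orientable (dil r ` S) \<longleftrightarrow> H_orientable S) \<and>
    (H_orientable_hor (left_transl pbar ` S) \<longleftrightarrow> H_orientable_hor S) \<and>
    (H_orientable_hor (dil r ` S) \<longleftrightarrow> H_orientable_hor S)"
proof -
  have "r \<noteq> 0" "1 / r \<noteq> 0"
    using \<open>r > 0\<close> by simp_all
  then show ?thesis
    using \<open>H_regular_surface S\<close>
    by (simp add: left_transl_image_eq_vimage dil_image_eq_vimage H_regular_surface_vimage_hsim
        H_orientable_vimage_hsim_iff H_orientable_hor_vimage_hsim_iff)
qed

end
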